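(* Let $q,\ell$ be primes satisfying one of the following: (1) $q\equiv 3 \pmod 8$, $\ell\equiv 5\pmod 8$, $q\not\equiv \ell \pmod 3$, and $q\neq 3$; (2) $q\equiv 11 \pmod{24}$, $\ell\equiv 5 \pmod{24}$, and $\left(\frac{q}{\ell}\right)=-1$; (3) $q\equiv \pm 3\pmod 8$, $\ell\equiv -1 \pmod{24}$, $\ell\not\equiv -1 \pmod q$, and $\ell$ is not a Mersenne prime. Let $S$ be either $\{2,q,\ell\}$ or $\{q,\ell\}$. Then the $S$-unit equation $16X+Y+Z$ has no proper points.
   Context: Let $S$ be a finite set of primes and $\alpha,\beta,\gamma$ pairwise coprime non-zero integers. A proper point of the $S$-unit equation $\alpha X+\beta Y+\gamma Z$ is a point $[x:y:z]\in\mathbb{P}^2(\mathbb{Q})$ with integer representative $(x,y,z)$, $\gcd(x,y,z)=1$, such that $\alpha x+\beta y+\gamma z=0$, $xyz\neq 0$, the set of primes dividing $xyz$ is exactly $S$, and $\alpha x,\beta y,\gamma z$ are pairwise coprime. $\left(\frac{q}{\ell}\right)$ is the Legendre symbol; a Mersenne prime is a prime of the form $2^k-1$. *)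

theory Defs
  imports "HOL-Number_Theory.Number_Theory"
begin

text \<open>
  Points of the projective plane over the rationals are the classes of non-zero rational triples
  modulo scaling by a non-zero rational.
\<close>

definition proj_rel :: "((rat \<times> rat \<times> rat) \<times> (rat \<times> rat \<times> rat)) set" where
  "proj_rel =
    {((x, y, z), (x', y', z')) | x y z x' y' z'.
       (x, y, z) \<noteq> (0, 0, 0) \<and> (x', y', z') \<noteq> (0, 0, 0) \<and>
       (\<exists>c. c \<noteq> 0 \<and> x' = c * x \<and> y' = c * y \<and> z' = c * z)}"

definition proj_plane :: "(rat \<times> rat \<times> rat) set set" where
  "proj_plane = (UNIV - {(0, 0, 0)}) // proj_rel"

definition proj_point :: "rat \<Rightarrow> rat \<Rightarrow> rat \<Rightarrow> (rat \<times> rat \<times> rat) set" where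
  "proj_point x y z = proj_rel `` {(x, y, z)}"

lemma proj_rel_iff:
  "((x, y, z), (x', y', z')) \<in> proj_rel \<longleftrightarrow>
     (x, y, z) \<noteq> (0, 0, 0) \<and> (x', y', z') \<noteq> (0, 0, 0) \<and>
     (\<exists>c. c \<noteq> 0 \<and> x' = c * x \<and> y' = c * y \<and> z' = c * z)"
  unfolding proj_rel_def by simp

lemma equiv_proj_rel: "equiv (UNIV - {(0, 0, 0)}) proj_rel"
proof (rule equivI)
  show "proj_rel \<subseteq> (UNIV - {(0, 0, 0)}) \<times> (UNIV - {(0, 0, 0)})"
    unfolding proj_rel_def by blast
  show "refl_on (UNIV - {(0, 0, 0)}) proj_rel"
  proof (rule refl_onI)
    fix u :: "rat \<times> rat \<times> rat" assume u: "u \<in> UNIV - {(0, 0, 0)}"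
    obtain x y z where xyz: "u = (x, y, z)" by (cases u)
    have "\<exists>c. c \<noteq> 0 \<and> x = c * x \<and> y = c * y \<and> z = c * z"
      by (rule exI[of _ 1]) simp
    then show "(u, u) \<in> proj_rel"
      using u unfolding xyz proj_rel_iff by blast
  qed
  show "sym proj_rel"
  proof (rule symI)
    fix u v assume uv: "(u, v) \<in> proj_rel"
    obtain x y z where u: "u = (x, y, z)" by (cases u)
    obtain x' y' z' where v: "v = (x', y', z')" by (cases v)
    from uv obtain c where c: "c \<noteq> 0" "x' = c * x" "y' = c * y" "z' = c * z"
      unfolding u v proj_rel_iff by blast
    have "\<exists>d. d \<noteq> 0 \<and> x = d * x' \<and> y = d * y' \<and> z = d * z'"
      by (rule exI[of _ "inverse c"]) (simp add: c)
    then show "(v, u) \<in> proj_rel"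
      using uv unfolding u v proj_rel_iff by blast
  qed
  show "trans proj_rel"
  proof (rule transI)
    fix u v w assume uv: "(u, v) \<in> proj_rel" and vw: "(v, w) \<in> proj_rel"
    obtain x y z where u: "u = (x, y, z)" by (cases u)
    obtain x' y' z' where v: "v = (x', y', z')" by (cases v)
    obtain x'' y'' z'' where w: "w = (x'', y'', z'')" by (cases w)
    from uv obtain c where c: "c \<noteq> 0" "x' = c * x" "y' = c * y" "z' = c * z"
      unfolding u v proj_rel_iff by blast
    from vw obtain d where d: "d \<noteq> 0" "x'' = d * x'" "y'' = d * y'" "z'' = d * z'"
      unfolding v w proj_rel_iff by blast
    have "\<exists>e. e \<noteq> 0 \<and> x'' = e * x \<and> y'' = e * y \<and> z'' = e * z"
      by (rule exI[of _ "d * c"]) (simp add: c d)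
    then show "(u, w) \<in> proj_rel"
      using uv vw unfolding u v w proj_rel_iff by blast
  qed
qed

text \<open>
  The proper points of the S-unit equation a X + b Y + c Z. A prime of type int is positive, so
  S is a set of ordinary primes. The standing assumptions (S a finite set of primes; a, b, c
  non-zero and pairwise coprime) are not repeated as side conditions here.
\<close>

definition proper_points :: "int set \<Rightarrow> int \<Rightarrow> int \<Rightarrow> int \<Rightarrow> (rat \<times> rat \<times> rat) set set" where
  "proper_points S a b c =
    {P \<in> proj_plane. \<exists>x y z :: int.
       P = proj_point (of_int x) (of_int y) (of_int z) \<and>
       gcd x (gcd y z) = 1 \<and>
       a * x + b * y + c * z = 0 \<and>
       x * y * z \<noteq> 0 \<and>
       {p. prime p \<and> p dvd x * y * z} = S \<and>
       coprime (a * x) (b * y) \<and> coprime (a * x) (c * z) \<and> coprime (b * y) (c * z)}"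

definition mersenne_prime :: "int \<Rightarrow> bool" where
  "mersenne_prime p \<longleftrightarrow> prime p \<and> (\<exists>k::nat. p = 2 ^ k - 1)"

end

theory Submission
  imports Defs
begin

text \<open>
  Let \<open>16 x + y + z = 0\<close> be a proper point. Then \<open>y\<close> and \<open>z\<close> are odd with \<open>y \<equiv> - z (mod 16)\<close>, so
  \<open>y z \<equiv> - 1 (mod 8)\<close>; as \<open>3 \<notin> S\<close>, the three coordinates are congruent to each other modulo \<open>3\<close>, so
  \<open>y z \<equiv> 1 (mod 3)\<close>. Hence \<open>y z \<equiv> 7 (mod 24)\<close>, while \<open>y z = \<plusminus>q\<^sup>b l\<^sup>c\<close>. The residues of \<open>q\<close> and
  \<open>l\<close> modulo \<open>24\<close> rule this out, except for \<open>q \<equiv> 11\<close>, \<open>l \<equiv> 5\<close>, \<open>y z > 0\<close> and \<open>b\<close>, \<open>c\<close> odd. Then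
  \<open>x = \<plusminus>2\<^sup>m\<close>, and the coordinate among \<open>y\<close>, \<open>z\<close> that is prime to \<open>l\<close> is \<open>\<plusminus>q\<^sup>j\<close> with the sign
  opposite to that of \<open>x\<close>. Modulo \<open>3\<close> this gives \<open>(-1)\<^sup>j = - (-1)\<^sup>m\<close>; modulo \<open>l\<close> it gives
  \<open>q\<^sup>j \<equiv> 2\<^bsup>m+4\<^esup>\<close>, whence \<open>(-1)\<^sup>j = (-1)\<^sup>m\<close> because \<open>q\<close> and \<open>2\<close> are non-residues modulo \<open>l\<close>.
\<close>

text \<open>Primes of \<open>P\<close> that do not divide \<open>n\<close> contribute
  \<open>p ^ 0\<close>, so it need not be known which of them occur.\<close>

lemma normalize_eq_prod_prime_powers:
  fixes n :: "'a :: factorial_semiring_multiplicative"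
  assumes "n \<noteq> 0" "finite P" "\<And>p. p \<in> P \<Longrightarrow> prime p"
    and "\<And>p. prime p \<Longrightarrow> p dvd n \<Longrightarrow> p \<in> P"
  shows "normalize n = (\<Prod>p\<in>P. p ^ multiplicity p n)"
proof -
  have "normalize n = (\<Prod>p\<in>prime_factors n. p ^ multiplicity p n)"
    using assms(1) by (simp add: prod_prime_factors)
  also have "\<dots> = (\<Prod>p\<in>P. p ^ multiplicity p n)"
    using assms
    by (intro prod.mono_neutral_left)
      (auto simp: in_prime_factors_iff dest: not_dvd_imp_multiplicity_0)
  finally show ?thesis .
qed

lemma power_mod_if_even:
  fixes a m :: int
  assumes "a ^ 2 mod m = 1 mod m"
  shows "a ^ n mod m = (if even n then 1 else a) mod m"
proof -
  have sq: "[(a ^ 2) ^ k = 1] (mod m)" for k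
    using cong_pow[of "a ^ 2" 1 m k] assms by (simp add: cong_def)
  show ?thesis
  proof (cases "even n")
    case True
    then obtain k where "n = 2 * k" by (rule evenE)
    then show ?thesis using sq[of k] by (simp add: cong_def power_mult)
  next
    case False
    then obtain k where "n = 2 * k + 1" by (rule oddE)
    then show ?thesis
      using cong_scalar_left[OF sq[of k], of a] by (simp add: cong_def power_mult)
  qed
qed

text \<open>Gauss's lemma: for l = 8k + 5, the numbers 2a with 1 \<le> a \<le> 4k + 2 exceed (l -
  1)/2 exactly when a > 2k + 1, which happens 2k + 1 times, an odd number.\<close>

lemma two_power_half_cong_minus_one:
  fixes l :: int
  assumes "prime l" "l mod 8 = 5"
  shows "[2 ^ nat ((l - 1) div 2) = -1] (mod l)"
proof -
  define k where "k = l div 8"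
  have l: "l = 8 * k + 5"
    using assms(2) unfolding k_def by presburger
  have k: "k \<ge> 0"
    using prime_gt_0_int[OF assms(1)] l by linarith
  define p where "p = nat l"
  have p: "int p = l"
    using l k by (simp add: p_def)
  interpret GAUSS p 2
  proof
    show "prime p"
      using assms(1) by (simp add: p_def)
    show "2 < p"
      using l k by (simp add: p_def)
    show "[2 \<noteq> 0] (mod int p)"
      using l k by (simp add: p cong_def)
  qed simp
  have half: "(int p - 1) div 2 = 4 * k + 2"
    by (simp add: p l)
  \<comment> \<open>Doubling the elements of \<open>A\<close> stays below \<open>l\<close>, so
    reduction modulo \<open>l\<close> changes nothing.\<close>
  have "C = (\<lambda>x. x * 2) ` A"
    unfolding C_def B_def image_image
    by (rule image_cong) (auto simp: A_def half p l)
  then have "E = (\<lambda>x. x * 2) ` {2 * k + 1 <.. 4 * k + 2}"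
    unfolding E_def A_def half using k by (auto simp: image_iff)
  then have "card E = card {2 * k + 1 <.. 4 * k + 2}"
    by (simp add: card_image inj_on_def)
  then have "card E = 2 * nat k + 1"
    using k by simp
  then show ?thesis
    using pre_gauss_lemma by (simp add: p)
qed

text \<open>The exceptional case modulo 24. Fixing \<open>l dvd y\<close> loses nothing, as y and z
  can be exchanged.\<close>

lemma no_solution_with_nonresidues:
  fixes q l x y z :: int
  assumes "prime q" "prime l" "q mod 24 = 11" "l mod 24 = 5" "Legendre q l = -1"
    and eq: "16 * x + y + z = 0" and nz: "x * y * z \<noteq> 0" and pos: "y * z > 0"
    and primes: "\<And>p. prime p \<Longrightarrow> p dvd x * y * z \<Longrightarrow> p \<in> {2, q, l}"
    and cop: "coprime (16 * x) y" "coprime (16 * x) z" "coprime y z"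
    and mod3: "[x = z] (mod 3)"
    and "l dvd y" "q dvd y * z"
  shows False
proof -
  have l5: "l mod 8 = 5"
    using assms(4) by presburger
  have ge: "l \<ge> 5"
    using assms(2,4) prime_gt_0_int[of l] by presburger
  have not_both: "\<not> (prime p \<and> p dvd a \<and> p dvd b)" if "coprime a b" for a b p :: int
    using that by (metis coprime_common_divisor not_prime_unit)
  \<comment> \<open>Coprimality with 16x excludes the prime 2, and coprimality with y excludes
    l.\<close>
  have "\<bar>z\<bar> = (\<Prod>p\<in>{q}. p ^ multiplicity p z)"
    unfolding normalize_int_def[symmetric]
  proof (rule normalize_eq_prod_prime_powers)
    fix p :: int assume "prime p" "p dvd z"
    then show "p \<in> {q}"
      using primes[of p] not_both[OF cop(2), of p] not_both[OF cop(3), of p] \<open>l dvd y\<close> by auto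
  qed (use assms(1) nz in auto)
  then obtain j where j: "\<bar>z\<bar> = q ^ j" by auto
  have "\<bar>x\<bar> = (\<Prod>p\<in>{2}. p ^ multiplicity p x)"
    unfolding normalize_int_def[symmetric]
  proof (rule normalize_eq_prod_prime_powers)
    fix p :: int assume p: "prime p" "p dvd x"
    \<comment> \<open>Either way q divides a coordinate coprime to x, and so does l; only 2
      remains.\<close>
    have "q dvd y \<or> q dvd z"
      using assms(1) \<open>q dvd y * z\<close> by (simp add: prime_dvd_mult_iff)
    then show "p \<in> {2}"
      using p primes[of p] not_both[OF cop(1), of p] not_both[OF cop(2), of p] \<open>l dvd y\<close>
      by auto
  qed (use nz in auto)
  then obtain m where m: "\<bar>x\<bar> = 2 ^ m" by auto
  have signs: "x < 0 \<and> z > 0 \<or> x > 0 \<and> z < 0"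
    using eq pos by (auto simp: zero_less_mult_iff)
  have "[(-1) ^ j = \<bar>z\<bar>] (mod 3)"
    unfolding j by (rule cong_pow) (use assms(3) in \<open>simp add: cong_def; presburger\<close>)
  also have "[\<bar>z\<bar> = - \<bar>x\<bar>] (mod 3)"
    using signs mod3 by (auto simp: cong_iff_dvd_diff dvd_diff_commute)
  also have "[- \<bar>x\<bar> = - ((-1) ^ m)] (mod 3)"
    unfolding m cong_minus_minus_iff by (rule cong_pow) (simp add: cong_def)
  finally have parity: "[(-1) ^ j = - ((-1) ^ m)] (mod (3 :: int))" .

  \<comment> \<open>Euler's exponent: it sends both q and 2 to -1 modulo l, so raising a congruence
    between their powers to it compares parities of exponents.\<close>
  define N where "N = nat ((l - 1) div 2)"
  have two: "[2 ^ N = -1] (mod l)"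
    unfolding N_def by (rule two_power_half_cong_minus_one) fact+
  have "[q ^ N = -1] (mod l)"
  proof -
    have "int (nat l) = l" "(nat l - 1) div 2 = N"
      using ge by (auto simp: N_def)
    moreover have "prime (nat l)" "2 < nat l"
      using assms(2) ge by simp_all
    ultimately show ?thesis
      using euler_criterion[of "nat l" q] assms(5) by (metis cong_sym)
  qed
  have "[\<bar>z\<bar> = 2 ^ (m + 4)] (mod l)"
  proof -
    \<comment> \<open>Both y and z have the sign opposite to that of x.\<close>
    have "16 * \<bar>x\<bar> - \<bar>z\<bar> = \<bar>y\<bar>"
      using eq pos signs by (auto simp: zero_less_mult_iff)
    then have "2 ^ (m + 4) - \<bar>z\<bar> = \<bar>y\<bar>"
      by (simp add: m power_add)
    then have "[2 ^ (m + 4) = \<bar>z\<bar>] (mod l)"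
      using \<open>l dvd y\<close> by (simp add: cong_iff_dvd_diff)
    then show ?thesis by (rule cong_sym)
  qed
  from cong_pow[OF this, of N] have "[(q ^ N) ^ j = (2 ^ N) ^ (m + 4)] (mod l)"
    unfolding j power_mult[symmetric] by (simp only: mult.commute)
  moreover have "[(q ^ N) ^ j = (-1) ^ j] (mod l)" "[(2 ^ N) ^ (m + 4) = (-1) ^ (m + 4)] (mod l)"
    by (rule cong_pow, fact)+
  ultimately have "[(-1) ^ j = (-1) ^ (m + 4)] (mod l)"
    by (meson cong_sym cong_trans)
  then have cong_l: "[(-1) ^ j = (-1) ^ m] (mod l)"
    by (simp add: power_add)
  have "\<not> l dvd 2"
    using ge zdvd_imp_le[of l 2] by auto
  then have "(-1 :: int) ^ j = (-1) ^ m"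
    using cong_l by (cases "even j"; cases "even m") (auto simp: cong_iff_dvd_diff)
  then show False
    using parity by (cases "even m") (auto simp: cong_iff_dvd_diff)
qed

theorem theorem1p6:
  fixes q l :: int and S :: "int set"
  assumes "prime q" and "prime l"
    and "([q = 3] (mod 8) \<and> [l = 5] (mod 8) \<and> \<not> [q = l] (mod 3) \<and> q \<noteq> 3) \<or>
         ([q = 11] (mod 24) \<and> [l = 5] (mod 24) \<and> Legendre q l = -1) \<or>
         (([q = 3] (mod 8) \<or> [q = -3] (mod 8)) \<and> [l = -1] (mod 24) \<and>
            \<not> [l = -1] (mod q) \<and> \<not> mersenne_prime l)"
    and "S = {2, q, l} \<or> S = {q, l}"
  shows "proper_points S 16 1 1 = {}"
proof (rule ccontr)
  assume "proper_points S 16 1 1 \<noteq> {}"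
  then obtain x y z :: int where eq: "16 * x + y + z = 0" and nz: "x * y * z \<noteq> 0"
    and S: "{p. prime p \<and> p dvd x * y * z} = S"
    and cop: "coprime (16 * x) y" "coprime (16 * x) z" "coprime y z"
    unfolding proper_points_def by auto
  have primes: "p \<in> {2, q, l}" if "prime p" "p dvd x * y * z" for p
    using S assms(4) that by blast
  \<comment> \<open>In the third case q = 3 would turn l \<equiv> -1 (mod 24) into l \<equiv> -1
    (mod q).\<close>
  have "\<not> (q = 3 \<and> [l = -1] (mod 24) \<and> \<not> [l = -1] (mod q))"
    using cong_dvd_modulus[of l "-1" 24 3] by auto
  then have "q \<noteq> 3" "l \<noteq> 3"
    using assms(3) by (auto simp: cong_def)
  then have "\<not> 3 dvd q" "\<not> 3 dvd l"
    using assms(1,2) primes_dvd_imp_eq[of 3 q] primes_dvd_imp_eq[of 3 l] by auto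
  have mod_3: "n mod 3 = (n mod 24) mod 3" for n :: int
    by (simp add: mod_mod_cancel)
  have mod_24: "n mod 24 = n mod 8 \<or> n mod 24 = n mod 8 + 8 \<or> n mod 24 = n mod 8 + 16" for n :: int
  proof -
    have "n mod 24 = 8 * (n div 8 mod 3) + n mod 8"
      using zmod_zmult2_eq[of 3 n 8] by simp
    moreover have "n div 8 mod 3 \<in> {0, 1, 2}"
      unfolding insert_iff empty_iff by presburger
    ultimately show ?thesis by auto
  qed
  have residue_24: "n mod 24 = 11 \<or> n mod 24 = 19" if "n mod 8 = 3" "\<not> 3 dvd n" for n :: int
    using that mod_24[of n] dvd_mod_iff[of 3 24 n] by auto
  have residue_24': "n mod 24 = 5 \<or> n mod 24 = 13" if "n mod 8 = 5" "\<not> 3 dvd n" for n :: int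
    using that mod_24[of n] dvd_mod_iff[of 3 24 n] by auto
  \<comment> \<open>The first two pairs come from case (1), the third from case (2), the last four
    from case (3).\<close>
  have residues: "(q mod 24, l mod 24) \<in>
      {(11, 13), (19, 5), (11, 5), (5, 23), (11, 23), (13, 23), (19, 23)}"
    using assms(3)
  proof (elim disjE conjE)
    assume *: "[q = 3] (mod 8)" "[l = 5] (mod 8)" "\<not> [q = l] (mod 3)"
    then have "q mod 24 = 11 \<or> q mod 24 = 19" "l mod 24 = 5 \<or> l mod 24 = 13"
      using residue_24 residue_24' \<open>\<not> 3 dvd q\<close> \<open>\<not> 3 dvd l\<close> by (simp_all add: cong_def)
    then show ?thesis
      using *(3) unfolding cong_def mod_3[of q] mod_3[of l] by (elim disjE) simp_all
  qed (use residue_24[of q] residue_24'[of q] \<open>\<not> 3 dvd q\<close> in \<open>auto simp: cong_def\<close>)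
  then have neq: "q \<noteq> l" "q \<noteq> 2" "l \<noteq> 2"
    by auto

  have "\<not> 3 dvd x * y * z"
    using primes[of 3] \<open>q \<noteq> 3\<close> \<open>l \<noteq> 3\<close> by auto
  then have "\<not> 3 dvd x" "\<not> 3 dvd y" "\<not> 3 dvd z"
    by auto
  then have "x mod 3 = 1 \<or> x mod 3 = 2" "y mod 3 = 1 \<or> y mod 3 = 2" "z mod 3 = 1 \<or> z mod 3 = 2"
    by presburger+
  \<comment> \<open>Since 16 \<equiv> 1 (mod 3), three non-zero residues sum to zero, which forces
    them to be equal.\<close>
  moreover have "(x mod 3 + y mod 3 + z mod 3) mod 3 = 0"
  proof -
    have "x + y + z = 3 * (- 5 * x)"
      using eq by simp
    then have "(x + y + z) mod 3 = 0"
      by (simp only: mod_mult_self1_is_0)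
    moreover have "[x mod 3 + y mod 3 + z mod 3 = x + y + z] (mod 3)"
      by (intro cong_add) (simp_all add: cong_def)
    ultimately show ?thesis by (simp only: cong_def)
  qed
  ultimately have mod3: "[x = z] (mod 3)" "[y = z] (mod 3)"
    unfolding cong_def by (elim disjE; simp)+
  have odd: "odd y" "odd z"
    using cop(1,2) by auto
  have yz: "(y * z) mod 24 = 7"
  proof -
    have "coprime (8 :: int) 3"
    proof (rule coprimeI)
      fix d :: int assume "d dvd 8" "d dvd 3"
      then have "d dvd 3 * 3 - 8" by (intro dvd_diff dvd_mult)
      then show "d dvd 1" by simp
    qed
    then have crt: "[n = k] (mod 24)" if "[n = k] (mod 8)" "[n = k] (mod 3)" for n k :: int
      using coprime_cong_mult[OF that] by simp
    have "(z * z) mod 24 = 1"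
    proof -
      have "z mod 8 \<in> {1, 3, 5, 7}" "z mod 3 \<in> {1, 2}"
        using odd(2) \<open>\<not> 3 dvd z\<close> unfolding insert_iff empty_iff by presburger+
      then have "(z * z) mod 8 = 1" "(z * z) mod 3 = 1"
        using mod_mult_eq[of z 8 z] mod_mult_eq[of z 3 z] by auto
      then show ?thesis
        using crt[of "z * z" 1] by (simp add: cong_def)
    qed
    \<comment> \<open>The factor 7 is -1 modulo 8 and 1 modulo 3, so it serves both moduli.\<close>
    have "[y = 7 * z] (mod 8)"
    proof -
      have "y - 7 * z = 8 * (- 2 * x - z)"
        using eq by simp
      then show ?thesis
        unfolding cong_iff_dvd_diff by (rule dvdI)
    qed
    moreover have "[y = 7 * z] (mod 3)"
    proof -
      have "z - 7 * z = 3 * (- 2 * z)" by simp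
      then have "[z = 7 * z] (mod 3)"
        unfolding cong_iff_dvd_diff by (rule dvdI)
      with mod3(2) show ?thesis by (rule cong_trans)
    qed
    ultimately have "[y = 7 * z] (mod 24)"
      by (rule crt)
    then have "[y * z = 7 * (z * z)] (mod 24)"
      using cong_scalar_right[of y "7 * z" 24 z] by (simp add: mult.assoc)
    also have "[7 * (z * z) = 7 * 1] (mod 24)"
      by (rule cong_scalar_left) (simp add: cong_def \<open>(z * z) mod 24 = 1\<close>)
    finally show ?thesis
      by (simp add: cong_def)
  qed
  define b where "b = multiplicity q (y * z)"
  define c where "c = multiplicity l (y * z)"
  have "\<bar>y * z\<bar> = (\<Prod>p\<in>{q, l}. p ^ multiplicity p (y * z))"
    unfolding normalize_int_def[symmetric]
  proof (rule normalize_eq_prod_prime_powers)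
    fix p :: int assume p: "prime p" "p dvd y * z"
    then have "p \<noteq> 2"
      using odd by auto
    moreover have "p dvd x * y * z"
      using p(2) by (simp add: mult.assoc)
    ultimately show "p \<in> {q, l}"
      using primes[of p] p(1) by auto
  qed (use assms(1,2) nz in auto)
  then have abs_yz: "\<bar>y * z\<bar> = q ^ b * l ^ c"
    using neq by (simp add: b_def c_def)
  have "\<bar>y * z\<bar> mod 24 = ((if even b then 1 else q) * (if even c then 1 else l)) mod 24"
  proof -
    have "q ^ 2 mod 24 = 1 mod 24" "l ^ 2 mod 24 = 1 mod 24"
      using residues power_mod[of q 24 2] power_mod[of l 24 2] by auto
    then show ?thesis
      unfolding abs_yz by (intro cong_mult[unfolded cong_def] power_mod_if_even)
  qed
  also have "\<dots> = ((if even b then 1 else q mod 24) * (if even c then 1 else l mod 24)) mod 24"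
    by (simp add: mod_mult_eq mod_mult_left_eq mod_mult_right_eq)
  finally have abs_mod: "\<bar>y * z\<bar> mod 24 =
      ((if even b then 1 else q mod 24) * (if even c then 1 else l mod 24)) mod 24" .
  have "\<bar>y * z\<bar> mod 24 = (if y * z > 0 then 7 else 17)"
    using yz by (auto simp: abs_if zmod_zminus1_eq_if)
  \<comment> \<open>A finite check: only 11 * 5 = 55 \<equiv> 7 hits a target; 17 is -7 modulo
    24.\<close>
  moreover have "u = 11 \<and> v = 5 \<and> odd b \<and> odd c \<and> positive"
    if "(u, v) \<in> {(11, 13), (19, 5), (11, 5), (5, 23), (11, 23), (13, 23), (19, 23)}"
      and "((if even b then 1 else u) * (if even c then 1 else v)) mod 24 =
        (if positive then 7 else 17)"
    for u v :: int and positive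
    using that by (cases "even b"; cases "even c"; cases positive) auto
  ultimately have exc: "q mod 24 = 11" "l mod 24 = 5" "odd b" "odd c" "y * z > 0"
    using abs_mod residues by (metis (no_types))+
  \<comment> \<open>These residues contradict cases (1) and (3), so case (2) holds and supplies the
    Legendre symbol.\<close>
  then have "[q = l] (mod 3)" "\<not> [l = -1] (mod 24)"
    unfolding cong_def mod_3[of q] mod_3[of l] by simp_all
  then have leg: "Legendre q l = -1"
    using assms(3) by auto
  have dvd: "q dvd y * z" "l dvd y * z"
    using exc(3,4) unfolding b_def c_def by (metis even_zero not_dvd_imp_multiplicity_0)+
  then consider "l dvd y" | "l dvd z"
    using assms(2) by (auto simp: prime_dvd_mult_iff)
  then show False
  proof cases
    case 1
    show False
      by (rule no_solution_with_nonresidues[of q l x y z])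
        (use assms(1,2) exc leg eq nz primes cop mod3 1 dvd in auto)
  next
    case 2
    have "[x = y] (mod 3)"
      using mod3 by (simp add: cong_def)
    then show False
      by (intro no_solution_with_nonresidues[of q l x z y])
        (use assms(1,2) exc leg eq nz primes cop 2 dvd in
          \<open>auto simp: coprime_commute mult_ac add_ac\<close>)
  qed
qed

end
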